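(* Consider the networked Markov decision process, the joint localized policy $\pi=(\pi_{\phi_1},\dots,\pi_{\phi_N})$, the individual Q-functions $Q_j^{\pi}$ and the truncated Q-functions $\hat Q_j^{\pi}$ described in the context, with an integer $\kappa\ge 0$ and nonnegative constants $c,\rho$. Assume: (A) (Exponential decay property.) For every $j\in\mathcal N$ and all $\mathbf o_{\mathcal N_j^\kappa},\ \mathbf o_{\mathcal N_{-j}^\kappa},\ \widetilde{\mathbf o}_{\mathcal N_{-j}^\kappa},\ \mathbf a_{\mathcal N_j^\kappa},\ \mathbf a_{\mathcal N_{-j}^\kappa},\ \widetilde{\mathbf a}_{\mathcal N_{-j}^\kappa}$, $$\bigl|Q_j^{\pi}(\mathbf o_{\mathcal N_j^\kappa},\mathbf o_{\mathcal N_{-j}^\kappa},\mathbf a_{\mathcal N_j^\kappa},\mathbf a_{\mathcal N_{-j}^\kappa})-Q_j^{\pi}(\mathbf o_{\mathcal N_j^\kappa},\widetilde{\mathbf o}_{\mathcal N_{-j}^\kappa},\mathbf a_{\mathcal N_j^\kappa},\widetilde{\mathbf a}_{\mathcal N_{-j}^\kappa})\bigr|\le c\rho^{\kappa+1}.$$ (B) (Truncation error.) For every $j\in\mathcal N$ and all $\mathbf o\in\mathcal O$, $\mathbf a\in\mathcal A$, $$\bigl|Q_j^{\pi}(\mathbf o_{\mathcal N_j^\kappa},\mathbf o_{\mathcal N_{-j}^\kappa},\mathbf a_{\mathcal N_j^\kappa},\mathbf a_{\mathcal N_{-j}^\kappa})-\hat Q_j^{\pi}(\mathbf o_{\mathcal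 N_j^\kappa},\mathbf a_{\mathcal N_j^\kappa})\bigr|\le c\rho^{\kappa+1}.$$ Then for every agent $i\in\mathcal N$, $$\Bigl|\ \mathbb E\Bigl[\mathrm D_{\mathrm{KL}}\Bigl(\pi_{\phi_i}(\cdot|\mathbf o_{i,t})\,\Big\|\,\frac{\exp\bigl(f(\mathbf o_t,\cdot,\mathbf a'_{-i,t})\bigr)}{Z\bigl(f(\mathbf o_t,\cdot,\mathbf a'_{-i,t})\bigr)}\Bigr)\Bigr]-\mathbb E\Bigl[\mathrm D_{\mathrm{KL}}\Bigl(\pi_{\phi_i}(\cdot|\mathbf o_{i,t})\,\Big\|\,\frac{\exp\bigl(\hat f(\mathbf o_t,\cdot,\mathbf a'_{-i,t})\bigr)}{Z\bigl(\hat f(\mathbf o_t,\cdot,\mathbf a'_{-i,t})\bigr)}\Bigr)\Bigr]\ \Bigr|\le 2c\rho^{\kappa+1},$$ where $$f(\mathbf o_t,\mathbf a_{i,t},\mathbf a'_{-i,t})=\frac1N\sum_{j\in\mathcal N}Q_j^{\pi}(\mathbf o_t,\mathbf a_{i,t},\mathbf a'_{-i,t}),\qquad \hat f(\mathbf o_t,\mathbf a_{i,t},\mathbf a'_{-i,t})=\frac1N\sum_{j\in\mathcal N_i^\kappa}\hat Q_j^{\pi}(\mathbf o_{\mathcal N_j^\kappa,t},\mathbf a_{i,t},\mathbf a'_{\mathcal N_j^\kappa\setminus\{i\},t}),$$ and both expectations are over $\mathbf o_t\sim\mathcal D$ and $\mathbf a'_{-i,t}$ sampled from the current policies of the agents other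 than $i$.
   Context: Networked MDP. There are $N$ agents, the vertices $\mathcal N=\{1,\dots,N\}$ of an undirected graph $\mathcal G=(\mathcal N,\mathcal E)$. Agent $i$ has a state $\mathbf s_i\in\mathcal S_i$, an action $\mathbf a_i\in\mathcal A_i$ and a local observation $\mathbf o_i\in\mathcal O_i$ (part of its local state). Global quantities are $\mathbf s=(\mathbf s_1,\dots,\mathbf s_N)$, $\mathbf a=(\mathbf a_1,\dots,\mathbf a_N)\in\mathcal A=\prod_i\mathcal A_i$, $\mathbf o=(\mathbf o_1,\dots,\mathbf o_N)\in\mathcal O=\prod_i\mathcal O_i$. Transitions satisfy $P(\mathbf s_{t+1}|\mathbf s_t,\mathbf a_t)=\prod_{i=1}^N P(\mathbf s_{i,t+1}|\mathbf s_{\mathcal N_i,t},\mathbf a_{i,t})$, where $\mathcal N_i$ is the neighborhood of $i$ including $i$ itself. Agent $i$ uses a localized stochastic policy, a probability density $\pi_{\phi_i}(\cdot|\mathbf o_{i,t})$ on $\mathcal A_i$ with parameter $\phi_i$, to choose $\mathbf a_{i,t}$, and receives stage reward $r_{i,t}=r_i(\mathbf o_{i,t},\mathbf a_{i,t})$. The global stage reward is $r_t=\frac1N\sum_i r_{i,t}$ and $\gamma$ is the discount factor. (The entropy temperature parameter is subsumed into the reward by rescaling.) Neighborhoods. For an integer $\kappa\ge0$, $\mathcal N_i^\kappa$ is the set of agents at graph distance at most $\kappa$ from $i$, and $\mathcal N_{-i}^\kappa=\mathcal N\setminus\mathcal N_i^\kappa$. For a subset $S$ of agents, $\mathbf o_S$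 and $\mathbf a_S$ are the tuples of observations and actions of agents in $S$; $\mathbf a_{-i}$ is the tuple of actions of all agents other than $i$. Arguments of functions are reordered as convenient, e.g. $Q_j^\pi(\mathbf o,\mathbf a)=Q_j^\pi(\mathbf o_{\mathcal N_j^\kappa},\mathbf o_{\mathcal N_{-j}^\kappa},\mathbf a_{\mathcal N_j^\kappa},\mathbf a_{\mathcal N_{-j}^\kappa})=Q_j^\pi(\mathbf o,\mathbf a_i,\mathbf a_{-i})$. Q-functions. $Q_i^\pi(\mathbf o,\mathbf a)=\mathbb E\bigl[\sum_{t=0}^\infty\gamma^t r_{i,t}\mid\mathbf o_0=\mathbf o,\mathbf a_0=\mathbf a\bigr]$ is the (real-valued) individual Q-function under $\pi$. The truncated Q-function is $$\hat Q_i^\pi(\mathbf o_{\mathcal N_i^\kappa},\mathbf a_{\mathcal N_i^\kappa})=\mathbb E_{\mathbf o_{\mathcal N_{-i}^\kappa},\mathbf a_{\mathcal N_{-i}^\kappa}}\bigl[Q_i^\pi(\mathbf o_{\mathcal N_i^\kappa},\mathbf o_{\mathcal N_{-i}^\kappa},\mathbf a_{\mathcal N_i^\kappa},\mathbf a_{\mathcal N_{-i}^\kappa})\bigr],$$ where the expectation over $\mathbf o_{\mathcal N_{-i}^\kappa},\mathbf a_{\mathcal N_{-i}^\kappa}$ may be with respect to an arbitrary distribution. Other notation. $\mathcal D$ is a distribution over global observations (sampling from a replay buffer). For a function $g$ of the action $\mathbf a_{i}\in\mathcal A_i$, $Z(g)=\int_{\mathcal A_i}\exp(g(\mathbf a_i))\,d\mathbf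 a_i$ is the partition function, so $\exp(g)/Z(g)$ is a probability density on $\mathcal A_i$. For densities $p,q$ on $\mathcal A_i$, $\mathrm D_{\mathrm{KL}}(p\|q)=\int_{\mathcal A_i}p\ln(p/q)\,d\mathbf a_i$. The components of $\mathbf a'_{-i,t}$ are sampled as $\mathbf a'_{j,t}\sim\pi_{\phi_j}(\cdot|\mathbf o_{j,t})$, $j\ne i$. It is understood that the functions are measurable, the partition functions are positive and finite, and the KL-divergences and their expectations are finite, so that all displayed quantities are well defined. *)

theory Defs
  imports "HOL-Probability.Probability" "HOL-Library.Extended_Nat"
begin
text \<open>
  Heterogeneous local spaces are families of measurable spaces over one common type each, and
  global quantities are elements of the corresponding products \<^const>\<open>PiM\<close>, hence extensional
  functions on the set of agents. The measure carried by \<open>actions M i\<close> is the reference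
  measure \<open>da\<close> of the \<open>i\<close>-th action space (Lebesgue measure, counting measure, \dots);
  for \<open>states\<close> and \<open>observations\<close> only the sigma-algebra matters. The observation of an agent is
  a part of its local state, extracted by \<open>obs_of\<close>.
  The transition kernel of agent \<open>i\<close> takes the tuple of states of its closed neighbourhood.
  \<open>belief M ob\<close> is the conditional law of the global state \<open>s_0\<close> given that the global
  observation \<open>o_0\<close> equals \<open>ob\<close>.
\<close>

record ('s, 'o, 'a) networked_mdp =
  num_agents   :: nat
  edges        :: "nat set set"
  states       :: "nat \<Rightarrow> 's measure"
  observations :: "nat \<Rightarrow> 'o measure"
  actions      :: "nat \<Rightarrow> 'a measure"
  obs_of       :: "nat \<Rightarrow> 's \<Rightarrow> 'o"
  trans        :: "nat \<Rightarrow> (nat \<Rightarrow> 's) \<Rightarrow> 'a \<Rightarrow> 's measure"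
  belief       :: "(nat \<Rightarrow> 'o) \<Rightarrow> (nat \<Rightarrow> 's) measure"
  reward       :: "nat \<Rightarrow> 'o \<Rightarrow> 'a \<Rightarrow> real"
  discount     :: real

type_synonym ('o, 'a) policy = "nat \<Rightarrow> 'o \<Rightarrow> 'a \<Rightarrow> real"

definition agents :: "('s, 'o, 'a, 'm) networked_mdp_scheme \<Rightarrow> nat set" where
  "agents M = {1..num_agents M}"

definition adj :: "('s, 'o, 'a, 'm) networked_mdp_scheme \<Rightarrow> (nat \<times> nat) set" where
  "adj M = {(u, v). {u, v} \<in> edges M}"

definition graph_dist :: "('s, 'o, 'a, 'm) networked_mdp_scheme \<Rightarrow> nat \<Rightarrow> nat \<Rightarrow> enat" where
  "graph_dist M i j = Inf (enat ` {n. (i, j) \<in> adj M ^^ n})"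

definition nbhd :: "('s, 'o, 'a, 'm) networked_mdp_scheme \<Rightarrow> nat \<Rightarrow> nat \<Rightarrow> nat set" where
  "nbhd M \<kappa> i = {j \<in> agents M. graph_dist M i j \<le> enat \<kappa>}"

definition far :: "('s, 'o, 'a, 'm) networked_mdp_scheme \<Rightarrow> nat \<Rightarrow> nat \<Rightarrow> nat set" where
  "far M \<kappa> i = agents M - nbhd M \<kappa> i"

abbreviation Ss :: "('s, 'o, 'a, 'm) networked_mdp_scheme \<Rightarrow> nat set \<Rightarrow> (nat \<Rightarrow> 's) measure" where
  "Ss M I \<equiv> PiM I (states M)"

abbreviation Os :: "('s, 'o, 'a, 'm) networked_mdp_scheme \<Rightarrow> nat set \<Rightarrow> (nat \<Rightarrow> 'o) measure" where
  "Os M I \<equiv> PiM I (observations M)"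

abbreviation As :: "('s, 'o, 'a, 'm) networked_mdp_scheme \<Rightarrow> nat set \<Rightarrow> (nat \<Rightarrow> 'a) measure" where
  "As M I \<equiv> PiM I (actions M)"

definition global_obs :: "('s, 'o, 'a, 'm) networked_mdp_scheme \<Rightarrow> (nat \<Rightarrow> 's) \<Rightarrow> nat \<Rightarrow> 'o" where
  "global_obs M s = (\<lambda>i\<in>agents M. obs_of M i (s i))"

definition is_networked_mdp :: "('s, 'o, 'a, 'm) networked_mdp_scheme \<Rightarrow> bool" where
  "is_networked_mdp M \<longleftrightarrow>
     1 \<le> num_agents M \<and>
     edges M \<subseteq> {{u, v} |u v. u \<in> agents M \<and> v \<in> agents M} \<and>
     (\<forall>i\<in>agents M.
        sigma_finite_measure (actions M i) \<and>
        obs_of M i \<in> states M i \<rightarrow>\<^sub>M observations M i \<and>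
        (\<lambda>(s, a). trans M i s a)
          \<in> Ss M (nbhd M 1 i) \<Otimes>\<^sub>M actions M i \<rightarrow>\<^sub>M prob_algebra (states M i) \<and>
        (\<lambda>(ob, a). reward M i ob a) \<in> borel_measurable (observations M i \<Otimes>\<^sub>M actions M i)) \<and>
     belief M \<in> Os M (agents M) \<rightarrow>\<^sub>M prob_algebra (Ss M (agents M)) \<and>
     (\<forall>ob\<in>space (Os M (agents M)). AE s in belief M ob. global_obs M s = ob) \<and>
     0 \<le> discount M \<and> discount M \<le> 1"

definition is_policy ::
    "('s, 'o, 'a, 'm) networked_mdp_scheme \<Rightarrow> ('o, 'a) policy \<Rightarrow> bool" where
  "is_policy M \<pi> \<longleftrightarrow>
     (\<forall>i\<in>agents M.
        (\<lambda>(ob, a). \<pi> i ob a) \<in> borel_measurable (observations M i \<Otimes>\<^sub>M actions M i) \<and>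
        (\<forall>ob\<in>space (observations M i).
           (\<forall>a\<in>space (actions M i). 0 \<le> \<pi> i ob a) \<and>
           prob_space (density (actions M i) (\<lambda>a. ennreal (\<pi> i ob a)))))"

definition action_law ::
    "('s, 'o, 'a, 'm) networked_mdp_scheme \<Rightarrow> ('o, 'a) policy \<Rightarrow> nat set \<Rightarrow> (nat \<Rightarrow> 'o)
      \<Rightarrow> (nat \<Rightarrow> 'a) measure" where
  "action_law M \<pi> I ob =
     PiM I (\<lambda>j. density (actions M j) (\<lambda>a. ennreal (\<pi> j (ob j) a)))"

definition global_trans ::
    "('s, 'o, 'a, 'm) networked_mdp_scheme \<Rightarrow> (nat \<Rightarrow> 's) \<Rightarrow> (nat \<Rightarrow> 'a) \<Rightarrow> (nat \<Rightarrow> 's) measure" where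
  "global_trans M s a =
     PiM (agents M) (\<lambda>i. trans M i (restrict s (nbhd M 1 i)) (a i))"

abbreviation SA ::
    "('s, 'o, 'a, 'm) networked_mdp_scheme \<Rightarrow> ((nat \<Rightarrow> 's) \<times> (nat \<Rightarrow> 'a)) measure" where
  "SA M \<equiv> Ss M (agents M) \<Otimes>\<^sub>M As M (agents M)"

definition init_law ::
    "('s, 'o, 'a, 'm) networked_mdp_scheme \<Rightarrow> (nat \<Rightarrow> 'o) \<Rightarrow> (nat \<Rightarrow> 'a)
      \<Rightarrow> ((nat \<Rightarrow> 's) \<times> (nat \<Rightarrow> 'a)) measure" where
  "init_law M ob a = distr (belief M ob) (SA M) (\<lambda>s. (s, a))"

definition step_law ::
    "('s, 'o, 'a, 'm) networked_mdp_scheme \<Rightarrow> ('o, 'a) policy \<Rightarrow> (nat \<Rightarrow> 's) \<times> (nat \<Rightarrow> 'a)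
      \<Rightarrow> ((nat \<Rightarrow> 's) \<times> (nat \<Rightarrow> 'a)) measure" where
  "step_law M \<pi> sa =
     global_trans M (fst sa) (snd sa) \<bind> (\<lambda>s'.
       distr (action_law M \<pi> (agents M) (global_obs M s')) (SA M) (\<lambda>a'. (s', a')))"

definition traj_kernel ::
    "('s, 'o, 'a, 'm) networked_mdp_scheme \<Rightarrow> ('o, 'a) policy \<Rightarrow> (nat \<Rightarrow> 'o) \<Rightarrow> (nat \<Rightarrow> 'a)
      \<Rightarrow> nat \<Rightarrow> (nat \<Rightarrow> (nat \<Rightarrow> 's) \<times> (nat \<Rightarrow> 'a)) \<Rightarrow> ((nat \<Rightarrow> 's) \<times> (nat \<Rightarrow> 'a)) measure" where
  "traj_kernel M \<pi> ob a t \<omega> =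
     (case t of 0 \<Rightarrow> init_law M ob a | Suc n \<Rightarrow> step_law M \<pi> (\<omega> n))"

text \<open>
  The law of \<open>(s_t, a_t)\<close>, \<open>t = 0, 1, \dots\<close>, conditionally on \<open>o_0 = ob\<close> and \<open>a_0 = a\<close>,
  obtained from the kernels by the Ionescu-Tulcea theorem; the hypotheses of that theorem are
  verified in \<open>Ionescu_Tulcea_traj_kernel\<close> below.
\<close>

definition traj_law ::
    "('s, 'o, 'a, 'm) networked_mdp_scheme \<Rightarrow> ('o, 'a) policy \<Rightarrow> (nat \<Rightarrow> 'o) \<Rightarrow> (nat \<Rightarrow> 'a)
      \<Rightarrow> (nat \<Rightarrow> (nat \<Rightarrow> 's) \<times> (nat \<Rightarrow> 'a)) measure" where
  "traj_law M \<pi> ob a =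
     projective_family.lim UNIV (Ionescu_Tulcea.CI (traj_kernel M \<pi> ob a) (\<lambda>_. SA M)) (\<lambda>_. SA M)"

definition stage_reward ::
    "('s, 'o, 'a, 'm) networked_mdp_scheme \<Rightarrow> nat \<Rightarrow> (nat \<Rightarrow> 's) \<times> (nat \<Rightarrow> 'a) \<Rightarrow> real" where
  "stage_reward M i sa = reward M i (obs_of M i (fst sa i)) (snd sa i)"

definition Q_fun ::
    "('s, 'o, 'a, 'm) networked_mdp_scheme \<Rightarrow> ('o, 'a) policy \<Rightarrow> nat \<Rightarrow> (nat \<Rightarrow> 'o) \<Rightarrow> (nat \<Rightarrow> 'a)
      \<Rightarrow> real" where
  "Q_fun M \<pi> i ob a = (\<integral>\<omega>. (\<Sum>t. discount M ^ t * stage_reward M i (\<omega> t)) \<partial>traj_law M \<pi> ob a)"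

definition Q_well_defined ::
    "('s, 'o, 'a, 'm) networked_mdp_scheme \<Rightarrow> ('o, 'a) policy \<Rightarrow> nat \<Rightarrow> bool" where
  "Q_well_defined M \<pi> i \<longleftrightarrow>
     (\<forall>ob\<in>space (Os M (agents M)). \<forall>a\<in>space (As M (agents M)).
        (AE \<omega> in traj_law M \<pi> ob a. summable (\<lambda>t. discount M ^ t * stage_reward M i (\<omega> t))) \<and>
        integrable (traj_law M \<pi> ob a)
          (\<lambda>\<omega>. \<Sum>t. discount M ^ t * stage_reward M i (\<omega> t))) \<and>
     (\<lambda>(ob, a). Q_fun M \<pi> i ob a) \<in> borel_measurable (Os M (agents M) \<Otimes>\<^sub>M As M (agents M))"

definition Q_split ::
    "('s, 'o, 'a, 'm) networked_mdp_scheme \<Rightarrow> ('o, 'a) policy \<Rightarrow> nat \<Rightarrow> nat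
      \<Rightarrow> (nat \<Rightarrow> 'o) \<Rightarrow> (nat \<Rightarrow> 'o) \<Rightarrow> (nat \<Rightarrow> 'a) \<Rightarrow> (nat \<Rightarrow> 'a) \<Rightarrow> real" where
  "Q_split M \<pi> \<kappa> i oN oF aN aF =
     Q_fun M \<pi> i (merge (nbhd M \<kappa> i) (far M \<kappa> i) (oN, oF))
                 (merge (nbhd M \<kappa> i) (far M \<kappa> i) (aN, aF))"

text \<open>
  \<open>\<nu> i oN aN\<close> is the averaging distribution of the observations and actions outside
  the \<open>\<kappa>\<close>-neighbourhood. It may depend on the agent and on the retained
  arguments; a single fixed distribution is the constant case.
\<close>

type_synonym ('o, 'a) weights =
  "nat \<Rightarrow> (nat \<Rightarrow> 'o) \<Rightarrow> (nat \<Rightarrow> 'a) \<Rightarrow> ((nat \<Rightarrow> 'o) \<times> (nat \<Rightarrow> 'a)) measure"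

definition Q_trunc ::
    "('s, 'o, 'a, 'm) networked_mdp_scheme \<Rightarrow> ('o, 'a) policy \<Rightarrow> nat \<Rightarrow> ('o, 'a) weights
      \<Rightarrow> nat \<Rightarrow> (nat \<Rightarrow> 'o) \<Rightarrow> (nat \<Rightarrow> 'a) \<Rightarrow> real" where
  "Q_trunc M \<pi> \<kappa> \<nu> i oN aN = (\<integral>(oF, aF). Q_split M \<pi> \<kappa> i oN oF aN aF \<partial>\<nu> i oN aN)"

definition valid_weights ::
    "('s, 'o, 'a, 'm) networked_mdp_scheme \<Rightarrow> ('o, 'a) policy \<Rightarrow> nat \<Rightarrow> ('o, 'a) weights
      \<Rightarrow> nat \<Rightarrow> bool" where
  "valid_weights M \<pi> \<kappa> \<nu> i \<longleftrightarrow>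
     (\<lambda>(oN, aN). \<nu> i oN aN)
       \<in> Os M (nbhd M \<kappa> i) \<Otimes>\<^sub>M As M (nbhd M \<kappa> i)
         \<rightarrow>\<^sub>M prob_algebra (Os M (far M \<kappa> i) \<Otimes>\<^sub>M As M (far M \<kappa> i)) \<and>
     (\<forall>oN\<in>space (Os M (nbhd M \<kappa> i)). \<forall>aN\<in>space (As M (nbhd M \<kappa> i)).
        integrable (\<nu> i oN aN) (\<lambda>(oF, aF). Q_split M \<pi> \<kappa> i oN oF aN aF))"

definition Z :: "'a measure \<Rightarrow> ('a \<Rightarrow> real) \<Rightarrow> real" where
  "Z A g = (\<integral>a. exp (g a) \<partial>A)"

definition Z_pos_finite :: "'a measure \<Rightarrow> ('a \<Rightarrow> real) \<Rightarrow> bool" where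
  "Z_pos_finite A g \<longleftrightarrow> integrable A (\<lambda>a. exp (g a)) \<and> 0 < Z A g"

definition gibbs :: "'a measure \<Rightarrow> ('a \<Rightarrow> real) \<Rightarrow> 'a \<Rightarrow> real" where
  "gibbs A g a = exp (g a) / Z A g"

definition D_KL :: "'a measure \<Rightarrow> ('a \<Rightarrow> real) \<Rightarrow> ('a \<Rightarrow> real) \<Rightarrow> real" where
  "D_KL A p q = (\<integral>a. p a * ln (p a / q a) \<partial>A)"

definition D_KL_finite :: "'a measure \<Rightarrow> ('a \<Rightarrow> real) \<Rightarrow> ('a \<Rightarrow> real) \<Rightarrow> bool" where
  "D_KL_finite A p q \<longleftrightarrow> integrable A (\<lambda>a. p a * ln (p a / q a))"

lemma (in sigma_finite_measure) D_KL_eq_KL_divergence: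
  assumes "p \<in> borel_measurable M" "\<And>a. a \<in> space M \<Longrightarrow> 0 \<le> p a"
    and "g \<in> borel_measurable M" "Z_pos_finite M g"
  shows "D_KL M p (gibbs M g)
         = KL_divergence (exp 1) (density M (gibbs M g)) (density M p)"
proof -
  have m: "gibbs M g \<in> borel_measurable M"
    unfolding gibbs_def[abs_def] using assms(3) by measurable
  have pos: "0 < gibbs M g a" for a
    using assms(4) by (simp add: gibbs_def Z_pos_finite_def)
  have "KL_divergence (exp 1) (density M (gibbs M g)) (density M p)
      = (\<integral>a. p a * log (exp 1) (p a / gibbs M g a) \<partial>M)"
    using assms m by (intro KL_density_density) (auto intro: less_imp_le[OF pos] simp: pos[THEN less_imp_neq, symmetric])
  then show ?thesis
    by (simp add: D_KL_def log_def)
qed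

text \<open>
  The tuple \<open>a'\<close> ranges over the actions of the agents other than \<open>i\<close>, and
  \<open>a'(i := x)\<close> is the joint action \<open>(x, a')\<close>.
\<close>

definition f_exact ::
    "('s, 'o, 'a, 'm) networked_mdp_scheme \<Rightarrow> ('o, 'a) policy \<Rightarrow> nat
      \<Rightarrow> (nat \<Rightarrow> 'o) \<Rightarrow> (nat \<Rightarrow> 'a) \<Rightarrow> 'a \<Rightarrow> real" where
  "f_exact M \<pi> i ob a' x =
     1 / real (num_agents M) * (\<Sum>j\<in>agents M. Q_fun M \<pi> j ob (a'(i := x)))"

definition f_trunc ::
    "('s, 'o, 'a, 'm) networked_mdp_scheme \<Rightarrow> ('o, 'a) policy \<Rightarrow> nat \<Rightarrow> ('o, 'a) weights \<Rightarrow> nat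
      \<Rightarrow> (nat \<Rightarrow> 'o) \<Rightarrow> (nat \<Rightarrow> 'a) \<Rightarrow> 'a \<Rightarrow> real" where
  "f_trunc M \<pi> \<kappa> \<nu> i ob a' x =
     1 / real (num_agents M) *
       (\<Sum>j\<in>nbhd M \<kappa> i.
          Q_trunc M \<pi> \<kappa> \<nu> j (restrict ob (nbhd M \<kappa> j)) (restrict (a'(i := x)) (nbhd M \<kappa> j)))"

definition sample_law ::
    "('s, 'o, 'a, 'm) networked_mdp_scheme \<Rightarrow> ('o, 'a) policy \<Rightarrow> (nat \<Rightarrow> 'o) measure \<Rightarrow> nat
      \<Rightarrow> ((nat \<Rightarrow> 'o) \<times> (nat \<Rightarrow> 'a)) measure" where
  "sample_law M \<pi> D i =
     D \<bind> (\<lambda>ob. distr (action_law M \<pi> (agents M - {i}) ob)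
                  (Os M (agents M) \<Otimes>\<^sub>M As M (agents M - {i})) (\<lambda>a'. (ob, a')))"

lemma measurable_PiM_prob_algebra:
  assumes fin: "finite I" and K: "\<And>i. i \<in> I \<Longrightarrow> K i \<in> L \<rightarrow>\<^sub>M prob_algebra (N i)"
  shows "(\<lambda>x. PiM I (\<lambda>i. K i x)) \<in> L \<rightarrow>\<^sub>M prob_algebra (PiM I N)"
proof -
  define K' where "K' x i = (if i \<in> I then K i x else return (count_space UNIV) undefined)" for x i
  have K'_eq: "PiM I (\<lambda>i. K i x) = PiM I (K' x)" for x
    by (intro PiM_cong) (auto simp: K'_def)
  have Kx: "sets (K i x) = sets (N i)" "prob_space (K i x)" if "x \<in> space L" "i \<in> I" for x i
    using measurable_space[OF K[OF that(2)] that(1)] by (auto simp: space_prob_algebra)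
  have ps: "product_prob_space (K' x)" if "x \<in> space L" for x
    unfolding K'_def using Kx[OF that]
    by (intro product_prob_spaceI) (auto intro: prob_space_return)
  show ?thesis
    unfolding K'_eq
  proof (rule measurable_prob_algebra_generated[OF sets_PiM Int_stable_prod_algebra prod_algebra_sets_into_space])
    fix x assume x: "x \<in> space L"
    interpret product_prob_space "K' x" I by (rule ps[OF x])
    show "prob_space (PiM I (K' x))" by (rule prob_space_PiM) unfold_locales
    show "sets (PiM I (K' x)) = sets (PiM I N)"
      by (intro sets_PiM_cong) (auto simp: K'_def Kx(1)[OF x])
  next
    fix A assume "A \<in> prod_algebra I N"
    then obtain E where A: "A = Pi\<^sub>E I E" and E: "E \<in> (\<Pi> i\<in>I. sets (N i))"
      by (auto simp: prod_algebra_eq_finite[OF fin])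
    have eq: "emeasure (PiM I (K' x)) A = (\<Prod>i\<in>I. emeasure (K i x) (E i))" if x: "x \<in> space L" for x
    proof -
      interpret product_prob_space "K' x" I by (rule ps[OF x])
      have "emeasure (PiM I (K' x)) A = (\<Prod>i\<in>I. emeasure (K' x i) (E i))"
        unfolding A using E Kx[OF x] fin by (intro emeasure_PiM) (auto simp: K'_def Pi_iff)
      then show ?thesis by (simp add: K'_def)
    qed
    have "(\<lambda>x. \<Prod>i\<in>I. emeasure (K i x) (E i)) \<in> borel_measurable L"
    proof (rule borel_measurable_prod_ennreal)
      fix i assume "i \<in> I"
      then show "(\<lambda>x. emeasure (K i x) (E i)) \<in> borel_measurable L"
        using E by (intro measurable_compose[OF measurable_prob_algebraD[OF K]
            measurable_emeasure_subprob_algebra]) auto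
    qed
    then show "(\<lambda>x. emeasure (PiM I (K' x)) A) \<in> borel_measurable L"
      by (subst measurable_cong[OF eq])
  qed
qed

lemma measurable_density_prob_algebra:
  assumes "sigma_finite_measure A"
    and "(\<lambda>(x, a). f x a) \<in> borel_measurable (L \<Otimes>\<^sub>M A)"
    and "\<And>x. x \<in> space L \<Longrightarrow> prob_space (density A (f x))"
  shows "(\<lambda>x. density A (f x)) \<in> L \<rightarrow>\<^sub>M prob_algebra A"
proof -
  interpret sigma_finite_measure A by fact
  note [measurable] = assms(2)
  show ?thesis
  proof (rule measurable_prob_algebra_generated[OF sets.sigma_sets_eq[symmetric] sets.Int_stable sets.space_closed])
    fix B assume B[measurable]: "B \<in> sets A"
    have "(\<lambda>x. \<integral>\<^sup>+a. f x a * indicator B a \<partial>A) \<in> borel_measurable L"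
      by measurable
    then show "(\<lambda>x. emeasure (density A (f x)) B) \<in> borel_measurable L"
      by (subst measurable_cong[OF emeasure_density]) auto
  qed (use assms(3) in auto)
qed

lemma finite_agents [simp]: "finite (agents M)"
  by (simp add: agents_def)

lemma measurable_global_obs:
  assumes "is_networked_mdp M"
  shows "global_obs M \<in> Ss M (agents M) \<rightarrow>\<^sub>M Os M (agents M)"
  unfolding global_obs_def[abs_def]
proof (rule measurable_restrict)
  fix i assume i: "i \<in> agents M"
  then have "obs_of M i \<in> states M i \<rightarrow>\<^sub>M observations M i"
    using assms by (simp add: is_networked_mdp_def)
  with i show "(\<lambda>s. obs_of M i (s i)) \<in> Ss M (agents M) \<rightarrow>\<^sub>M observations M i"
    by (intro measurable_compose[OF measurable_component_singleton])
qed

lemma measurable_action_law: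
  assumes "is_networked_mdp M" "is_policy M \<pi>" "I \<subseteq> agents M"
  shows "action_law M \<pi> I \<in> Os M (agents M) \<rightarrow>\<^sub>M prob_algebra (As M I)"
  unfolding action_law_def[abs_def]
proof (rule measurable_PiM_prob_algebra)
  show "finite I" by (rule finite_subset[OF assms(3) finite_agents])
  fix i assume "i \<in> I"
  then have i: "i \<in> agents M" using assms(3) by auto
  have sf: "sigma_finite_measure (actions M i)"
    using assms(1) i by (simp add: is_networked_mdp_def)
  have [measurable]: "(\<lambda>(ob, a). \<pi> i ob a) \<in> borel_measurable (observations M i \<Otimes>\<^sub>M actions M i)"
    using assms(2) i by (simp add: is_policy_def)
  have ps: "prob_space (density (actions M i) (\<lambda>a. ennreal (\<pi> i ob a)))"
      if "ob \<in> space (observations M i)" for ob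
    using assms(2) i that by (simp add: is_policy_def)
  have "(\<lambda>ob. density (actions M i) (\<lambda>a. ennreal (\<pi> i ob a)))
      \<in> observations M i \<rightarrow>\<^sub>M prob_algebra (actions M i)"
    by (rule measurable_density_prob_algebra[OF sf _ ps]) measurable
  then show "(\<lambda>ob. density (actions M i) (\<lambda>a. ennreal (\<pi> i (ob i) a)))
      \<in> Os M (agents M) \<rightarrow>\<^sub>M prob_algebra (actions M i)"
    by (rule measurable_compose[OF measurable_component_singleton[OF i]])
qed

lemma nbhd_subset: "nbhd M \<kappa> i \<subseteq> agents M"
  by (auto simp: nbhd_def)

lemma measurable_global_trans:
  assumes "is_networked_mdp M"
  shows "(\<lambda>sa. global_trans M (fst sa) (snd sa)) \<in> SA M \<rightarrow>\<^sub>M prob_algebra (Ss M (agents M))"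
  unfolding global_trans_def
proof (intro measurable_PiM_prob_algebra)
  fix i assume i: "i \<in> agents M"
  have "(\<lambda>sa. (restrict (fst sa) (nbhd M 1 i), snd sa i))
      \<in> SA M \<rightarrow>\<^sub>M Ss M (nbhd M 1 i) \<Otimes>\<^sub>M actions M i"
    using i by (intro measurable_Pair measurable_compose[OF measurable_fst measurable_restrict_subset[OF nbhd_subset]]
        measurable_compose[OF measurable_snd measurable_component_singleton])
  moreover have "(\<lambda>(s, a). trans M i s a)
      \<in> Ss M (nbhd M 1 i) \<Otimes>\<^sub>M actions M i \<rightarrow>\<^sub>M prob_algebra (states M i)"
    using assms i by (simp add: is_networked_mdp_def)
  ultimately have "(\<lambda>sa. (\<lambda>(s, a). trans M i s a) (restrict (fst sa) (nbhd M 1 i), snd sa i))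
      \<in> SA M \<rightarrow>\<^sub>M prob_algebra (states M i)"
    by (rule measurable_compose)
  then show "(\<lambda>sa. trans M i (restrict (fst sa) (nbhd M 1 i)) (snd sa i))
      \<in> SA M \<rightarrow>\<^sub>M prob_algebra (states M i)"
    by simp
qed simp

lemma measurable_step_law:
  assumes "is_networked_mdp M" "is_policy M \<pi>"
  shows "step_law M \<pi> \<in> SA M \<rightarrow>\<^sub>M prob_algebra (SA M)"
  unfolding step_law_def[abs_def]
proof (rule measurable_bind_prob_space[OF measurable_global_trans[OF assms(1)]])
  have "(\<lambda>s'. action_law M \<pi> (agents M) (global_obs M s'))
      \<in> Ss M (agents M) \<rightarrow>\<^sub>M prob_algebra (As M (agents M))"
    by (rule measurable_compose[OF measurable_global_obs measurable_action_law]) (use assms in auto)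
  then show "(\<lambda>s'. distr (action_law M \<pi> (agents M) (global_obs M s')) (SA M) (Pair s'))
      \<in> Ss M (agents M) \<rightarrow>\<^sub>M prob_algebra (SA M)"
    by (rule measurable_distr_prob_space2) simp
qed

lemma init_law_in_prob_algebra:
  assumes "is_networked_mdp M" "ob \<in> space (Os M (agents M))" "a \<in> space (As M (agents M))"
  shows "init_law M ob a \<in> space (prob_algebra (SA M))"
proof -
  have b: "belief M ob \<in> space (prob_algebra (Ss M (agents M)))"
    using assms(1,2) by (auto simp: is_networked_mdp_def dest: measurable_space)
  have "(\<lambda>s. (s, a)) \<in> Ss M (agents M) \<rightarrow>\<^sub>M SA M"
    using assms(3) by (intro measurable_Pair) auto
  from measurable_space[OF measurable_distr_prob_space[OF this] b] show ?thesis
    by (simp add: init_law_def)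
qed

lemma Ionescu_Tulcea_traj_kernel:
  assumes "is_networked_mdp M" "is_policy M \<pi>"
    and "ob \<in> space (Os M (agents M))" "a \<in> space (As M (agents M))"
  shows "Ionescu_Tulcea (traj_kernel M \<pi> ob a) (\<lambda>_. SA M)"
proof -
  have k: "traj_kernel M \<pi> ob a t \<in> PiM {0..<t} (\<lambda>_. SA M) \<rightarrow>\<^sub>M prob_algebra (SA M)" for t
  proof (cases t)
    case 0
    then show ?thesis
      using init_law_in_prob_algebra[OF assms(1,3,4)] by (simp add: traj_kernel_def[abs_def])
  next
    case (Suc n)
    then have "(\<lambda>\<omega>. \<omega> n) \<in> PiM {0..<t} (\<lambda>_. SA M) \<rightarrow>\<^sub>M SA M"
      by simp
    from measurable_compose[OF this measurable_step_law[OF assms(1,2)]] Suc show ?thesis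
      by (simp add: traj_kernel_def[abs_def])
  qed
  show ?thesis
  proof (rule Ionescu_Tulcea.intro)
    show "traj_kernel M \<pi> ob a t \<in> PiM {0..<t} (\<lambda>_. SA M) \<rightarrow>\<^sub>M subprob_algebra (SA M)" for t
      by (rule measurable_prob_algebraD[OF k])
    show "prob_space (traj_kernel M \<pi> ob a t \<omega>)" if "\<omega> \<in> space (PiM {0..<t} (\<lambda>_. SA M))" for t \<omega>
      using measurable_space[OF k that] by (simp add: space_prob_algebra)
  qed
qed

lemma sample_law_in_prob_algebra:
  assumes "is_networked_mdp M" "is_policy M \<pi>"
    and "D \<in> space (prob_algebra (Os M (agents M)))"
  shows "sample_law M \<pi> D i
           \<in> space (prob_algebra (Os M (agents M) \<Otimes>\<^sub>M As M (agents M - {i})))"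
proof -
  have "(\<lambda>ob. distr (action_law M \<pi> (agents M - {i}) ob)
            (Os M (agents M) \<Otimes>\<^sub>M As M (agents M - {i})) (Pair ob))
      \<in> Os M (agents M) \<rightarrow>\<^sub>M prob_algebra (Os M (agents M) \<Otimes>\<^sub>M As M (agents M - {i}))"
    by (rule measurable_distr_prob_space2[OF measurable_action_law]) (use assms in auto)
  from prob_space_bind'[OF assms(3) this] sets_bind'[OF assms(3) this] show ?thesis
    by (simp add: sample_law_def space_prob_algebra)
qed

end

theory Submission
  imports Defs
begin

text \<open>
  The divergence \<open>D_KL p (gibbs g)\<close> sees the energy \<open>g\<close> only up to an additive constant, because
  such a constant cancels against the logarithm of the partition function. Hence \<open>f_exact\<close> and
  \<open>f_trunc\<close> need not be close to each other: it suffices that, as functions of the action \<open>x\<close> of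
  agent \<open>i\<close>, they differ by a constant \<open>K\<close> up to the error \<open>\<epsilon> = c * \<rho> ^ (\<kappa> + 1)\<close>.

  The constant comes from the agents \<open>j\<close> that \<open>f_trunc\<close> drops. Graph distance is symmetric, so
  those are the agents for which \<open>i\<close> lies outside the \<open>\<kappa>\<close>-neighbourhood of \<open>j\<close>, and by exponential
  decay \<open>Q_fun M \<pi> j\<close> moves by at most \<open>\<epsilon>\<close> when \<open>x\<close> alone is changed
  (\<open>Q_fun_far_action_insensitive\<close>). Their contribution therefore stays within \<open>\<epsilon>\<close> of its value
  at any reference action, and this value is absorbed into \<open>K\<close>. An agent that is kept contributes the
  truncation error, again at most \<open>\<epsilon>\<close>. Since the agents are averaged, the total error is at most
  \<open>\<epsilon>\<close> (\<open>f_exact_f_trunc_near_constant\<close>).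

  The factor \<open>2\<close> arises because the error enters the divergence twice, through the mean energy
  under \<open>p\<close> and through \<open>ln (Z g)\<close>, each time by at most \<open>\<epsilon>\<close> (\<open>D_KL_gibbs_diff_le\<close>). This bound is
  uniform in the sampled observations and actions, so it survives taking expectations.
\<close>

section \<open>Symmetry of graph neighbourhoods\<close>

lemma graph_dist_commute: "graph_dist M i j = graph_dist M j i"
proof -
  have "sym (adj M)"
    by (auto simp: sym_def adj_def insert_commute)
  then have "(adj M)\<inverse> = adj M"
    by (simp add: sym_conv_converse_eq)
  then have "(adj M ^^ n)\<inverse> = adj M ^^ n" for n
    by (induction n) (simp_all add: converse_relcomp relpow_commute)
  then have "{n. (i, j) \<in> adj M ^^ n} = {n. (j, i) \<in> adj M ^^ n}"
    by (metis converse_iff)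
  then show ?thesis
    by (simp add: graph_dist_def)
qed

lemma nbhd_commute:
  assumes "i \<in> agents M" "j \<in> agents M"
  shows "i \<in> nbhd M \<kappa> j \<longleftrightarrow> j \<in> nbhd M \<kappa> i"
  using assms by (simp add: nbhd_def graph_dist_commute[of M i j])

section \<open>Dropped agents depend weakly on the action\<close>

lemma Q_split_restrict:
  assumes "ob \<in> space (Os M (agents M))" "a \<in> space (As M (agents M))"
  shows "Q_split M \<pi> \<kappa> j (restrict ob (nbhd M \<kappa> j)) (restrict ob (far M \<kappa> j))
           (restrict a (nbhd M \<kappa> j)) (restrict a (far M \<kappa> j)) = Q_fun M \<pi> j ob a"
proof -
  have "nbhd M \<kappa> j \<union> far M \<kappa> j = agents M"
    using nbhd_subset[of M \<kappa> j] by (auto simp: far_def)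
  moreover have "ob \<in> extensional (agents M)" "a \<in> extensional (agents M)"
    using assms by (auto simp: space_PiM PiE_def)
  ultimately show ?thesis
    by (simp add: Q_split_def extensional_restrict)
qed

text \<open>
  Changing the action of an agent outside the neighbourhood of \<open>j\<close> is the special case of the decay
  property in which all observations and all other actions are left alone.
\<close>

lemma Q_fun_far_action_insensitive:
  assumes decay:
      "\<forall>oN\<in>space (Os M (nbhd M \<kappa> j)). \<forall>oF\<in>space (Os M (far M \<kappa> j)). \<forall>oF'\<in>space (Os M (far M \<kappa> j)).
         \<forall>aN\<in>space (As M (nbhd M \<kappa> j)). \<forall>aF\<in>space (As M (far M \<kappa> j)). \<forall>aF'\<in>space (As M (far M \<kappa> j)).
           \<bar>Q_split M \<pi> \<kappa> j oN oF aN aF - Q_split M \<pi> \<kappa> j oN oF' aN aF'\<bar> \<le> \<epsilon>"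
    and ob: "ob \<in> space (Os M (agents M))"
    and ax: "a(i := x) \<in> space (As M (agents M))"
    and ay: "a(i := y) \<in> space (As M (agents M))"
    and i: "i \<notin> nbhd M \<kappa> j"
  shows "\<bar>Q_fun M \<pi> j ob (a(i := x)) - Q_fun M \<pi> j ob (a(i := y))\<bar> \<le> \<epsilon>"
proof -
  have far: "far M \<kappa> j \<subseteq> agents M"
    by (auto simp: far_def)
  have same: "restrict (a(i := x)) (nbhd M \<kappa> j) = restrict (a(i := y)) (nbhd M \<kappa> j)"
    using i by (auto simp: restrict_def fun_eq_iff)
  have restr: "restrict z I \<in> space (PiM I N)"
    if "z \<in> space (PiM (agents M) N)" "I \<subseteq> agents M" for z :: "nat \<Rightarrow> 'z" and N I
    using that by (auto simp: space_PiM)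
  have "\<bar>Q_split M \<pi> \<kappa> j (restrict ob (nbhd M \<kappa> j)) (restrict ob (far M \<kappa> j))
           (restrict (a(i := x)) (nbhd M \<kappa> j)) (restrict (a(i := x)) (far M \<kappa> j))
       - Q_split M \<pi> \<kappa> j (restrict ob (nbhd M \<kappa> j)) (restrict ob (far M \<kappa> j))
           (restrict (a(i := x)) (nbhd M \<kappa> j)) (restrict (a(i := y)) (far M \<kappa> j))\<bar> \<le> \<epsilon>"
    using decay restr[OF ob nbhd_subset] restr[OF ob far] restr[OF ax nbhd_subset]
      restr[OF ax far] restr[OF ay far] by blast
  then show ?thesis
    using Q_split_restrict[OF ob ax, of \<pi> \<kappa> j] Q_split_restrict[OF ob ay, of \<pi> \<kappa> j]
    by (simp add: same)
qed

text \<open>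
  Closeness without \<open>K\<close> fails in general: the Q-functions of the dropped agents may be large, and
  only their variation in \<open>x\<close> is small.
\<close>

lemma f_exact_f_trunc_near_constant:
  assumes agents: "1 \<le> num_agents M"
    and decay:
      "\<forall>j\<in>agents M.
         \<forall>oN\<in>space (Os M (nbhd M \<kappa> j)). \<forall>oF\<in>space (Os M (far M \<kappa> j)). \<forall>oF'\<in>space (Os M (far M \<kappa> j)).
         \<forall>aN\<in>space (As M (nbhd M \<kappa> j)). \<forall>aF\<in>space (As M (far M \<kappa> j)). \<forall>aF'\<in>space (As M (far M \<kappa> j)).
           \<bar>Q_split M \<pi> \<kappa> j oN oF aN aF - Q_split M \<pi> \<kappa> j oN oF' aN aF'\<bar> \<le> \<epsilon>"
    and truncation:
      "\<forall>j\<in>agents M. \<forall>ob\<in>space (Os M (agents M)). \<forall>a\<in>space (As M (agents M)).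
         \<bar>Q_fun M \<pi> j ob a - Q_trunc M \<pi> \<kappa> \<nu> j (restrict ob (nbhd M \<kappa> j)) (restrict a (nbhd M \<kappa> j))\<bar>
           \<le> \<epsilon>"
    and i: "i \<in> agents M"
    and ob: "ob \<in> space (Os M (agents M))"
    and a': "a' \<in> space (As M (agents M - {i}))"
  shows "\<exists>K. \<forall>x\<in>space (actions M i). \<bar>f_exact M \<pi> i ob a' x - f_trunc M \<pi> \<kappa> \<nu> i ob a' x - K\<bar> \<le> \<epsilon>"
proof -
  define N where "N = real (num_agents M)"
  \<comment> \<open>If the action space is empty, the reference action is arbitrary and the claim is vacuous.\<close>
  define x0 where "x0 = (SOME x. x \<in> space (actions M i))"
  define q where "q j x = Q_fun M \<pi> j ob (a'(i := x))" for j x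
  define qt where "qt j x =
    Q_trunc M \<pi> \<kappa> \<nu> j (restrict ob (nbhd M \<kappa> j)) (restrict (a'(i := x)) (nbhd M \<kappa> j))" for j x
  define err where "err j x = (if j \<in> nbhd M \<kappa> i then q j x - qt j x else q j x - q j x0)" for j x
  define K where "K = 1 / N * (\<Sum>j\<in>agents M - nbhd M \<kappa> i. q j x0)"
  have N: "N > 0" "real (card (agents M)) = N"
    using agents by (auto simp: N_def agents_def)
  have joint: "a'(i := x) \<in> space (As M (agents M))" if "x \<in> space (actions M i)" for x
    using a' that i by (auto simp: space_PiM PiE_def extensional_def)
  have split: "f_exact M \<pi> i ob a' x - f_trunc M \<pi> \<kappa> \<nu> i ob a' x - K
      = 1 / N * (\<Sum>j\<in>agents M. err j x)" for x
  proof -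
    have near_far: "sum h (agents M) = sum h (agents M - nbhd M \<kappa> i) + sum h (nbhd M \<kappa> i)"
      for h :: "nat \<Rightarrow> real"
      by (rule sum.subset_diff[OF nbhd_subset finite_agents])
    have "(\<Sum>j\<in>agents M. err j x)
        = (\<Sum>j\<in>agents M - nbhd M \<kappa> i. q j x - q j x0) + (\<Sum>j\<in>nbhd M \<kappa> i. q j x - qt j x)"
      unfolding near_far by (simp add: err_def)
    also have "\<dots> = (\<Sum>j\<in>agents M. q j x) - (\<Sum>j\<in>nbhd M \<kappa> i. qt j x)
        - (\<Sum>j\<in>agents M - nbhd M \<kappa> i. q j x0)"
      unfolding near_far[of "\<lambda>j. q j x"] by (simp add: sum_subtractf)
    finally show ?thesis
      by (simp add: f_exact_def f_trunc_def K_def q_def qt_def N_def[symmetric] right_diff_distrib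
          diff_divide_distrib)
  qed
  have err: "\<bar>err j x\<bar> \<le> \<epsilon>" if j: "j \<in> agents M" and x: "x \<in> space (actions M i)" for j x
  proof (cases "j \<in> nbhd M \<kappa> i")
    case True
    then show ?thesis
      using truncation j ob joint[OF x] by (simp add: err_def q_def qt_def)
  next
    case False
    then have "i \<notin> nbhd M \<kappa> j"
      using nbhd_commute[OF i j] by simp
    moreover have "x0 \<in> space (actions M i)"
      unfolding x0_def by (rule someI[of "\<lambda>x. x \<in> space (actions M i)", OF x])
    ultimately show ?thesis
      using False Q_fun_far_action_insensitive[OF bspec[OF decay j] ob joint[OF x] joint]
      by (simp add: err_def q_def)
  qed
  have "\<bar>f_exact M \<pi> i ob a' x - f_trunc M \<pi> \<kappa> \<nu> i ob a' x - K\<bar> \<le> \<epsilon>"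
    if x: "x \<in> space (actions M i)" for x
  proof -
    have "\<bar>\<Sum>j\<in>agents M. err j x\<bar> \<le> (\<Sum>j\<in>agents M. \<bar>err j x\<bar>)"
      by (rule sum_abs)
    also have "\<dots> \<le> N * \<epsilon>"
      using sum_bounded_above[of "agents M" "\<lambda>j. \<bar>err j x\<bar>" \<epsilon>] err[OF _ x] N(2) by simp
    finally show ?thesis
      using N(1) unfolding split by (simp add: abs_mult field_simps)
  qed
  then show ?thesis
    by blast
qed

section \<open>Stability of the divergence from a Gibbs density\<close>

lemma ln_Z_le:
  assumes g: "Z_pos_finite A g" and h: "Z_pos_finite A h"
    and le: "\<And>a. a \<in> space A \<Longrightarrow> g a \<le> h a + C"
  shows "ln (Z A g) \<le> ln (Z A h) + C"
proof -
  have "exp (g a) \<le> exp C * exp (h a)" if "a \<in> space A" for a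
    using le[OF that] by (simp add: exp_add[symmetric] add.commute)
  then have "Z A g \<le> (\<integral>a. exp C * exp (h a) \<partial>A)"
    unfolding Z_def using g h by (intro integral_mono) (auto simp: Z_pos_finite_def)
  also have "\<dots> = exp C * Z A h"
    by (simp add: Z_def)
  finally have "ln (Z A g) \<le> ln (exp C * Z A h)"
    using g h by (simp add: Z_pos_finite_def)
  also have "\<dots> = ln (Z A h) + C"
    using h by (simp add: Z_pos_finite_def ln_mult)
  finally show ?thesis .
qed

text \<open>
  The two integrands already differ by at most \<open>2 * \<epsilon> * p a\<close> pointwise: where \<open>p\<close> does not vanish,
  the term \<open>ln (p a)\<close> cancels and the remaining log-ratio of the two Gibbs densities is the
  difference of the energies minus that of the log partition functions, each within \<open>\<epsilon>\<close> of \<open>K\<close>.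
\<close>

lemma D_KL_gibbs_diff_le:
  assumes p: "p \<in> borel_measurable A" "\<And>a. a \<in> space A \<Longrightarrow> 0 \<le> p a"
    and prob: "prob_space (density A (\<lambda>a. ennreal (p a)))"
    and Zg: "Z_pos_finite A g" and Zh: "Z_pos_finite A h"
    and fin: "D_KL_finite A p (gibbs A g)" "D_KL_finite A p (gibbs A h)"
    and near: "\<And>a. a \<in> space A \<Longrightarrow> \<bar>g a - h a - K\<bar> \<le> \<epsilon>"
  shows "\<bar>D_KL A p (gibbs A g) - D_KL A p (gibbs A h)\<bar> \<le> 2 * \<epsilon>"
proof -
  have near': "g a \<le> h a + (K + \<epsilon>)" "h a \<le> g a + (\<epsilon> - K)" if "a \<in> space A" for a
    using near[OF that] by linarith+
  have lnZ: "\<bar>ln (Z A g) - ln (Z A h) - K\<bar> \<le> \<epsilon>"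
    using ln_Z_le[OF Zg Zh near'(1)] ln_Z_le[OF Zh Zg near'(2)] by linarith
  have "(\<integral>\<^sup>+a. ennreal (p a) \<partial>A) = 1"
    using prob_space.emeasure_space_1[OF prob] p(1)
    by (simp add: emeasure_density cong: nn_integral_cong)
  then have "has_bochner_integral A p 1"
    using p by (intro has_bochner_integral_nn_integral) (auto simp: AE_I2)
  then have int_p: "integrable A p" "(\<integral>a. p a \<partial>A) = 1"
    by (auto simp: has_bochner_integral_iff)
  have pointwise: "\<bar>p a * ln (p a / gibbs A g a) - p a * ln (p a / gibbs A h a)\<bar> \<le> 2 * \<epsilon> * p a"
    if a: "a \<in> space A" for a
  proof (cases "p a = 0")
    case False
    then have pos: "p a > 0"
      using p(2)[OF a] by simp
    have ln_ratio: "ln (p a / gibbs A k a) = ln (p a) - k a + ln (Z A k)" if "Z_pos_finite A k" for k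
      using pos that by (simp add: gibbs_def Z_pos_finite_def ln_div ln_mult)
    have "\<bar>ln (p a / gibbs A g a) - ln (p a / gibbs A h a)\<bar> \<le> 2 * \<epsilon>"
      using near[OF a] lnZ unfolding ln_ratio[OF Zg] ln_ratio[OF Zh] by linarith
    then show ?thesis
      using pos by (simp add: right_diff_distrib[symmetric] abs_mult mult.commute)
  qed simp
  have "\<bar>D_KL A p (gibbs A g) - D_KL A p (gibbs A h)\<bar>
      = \<bar>\<integral>a. p a * ln (p a / gibbs A g a) - p a * ln (p a / gibbs A h a) \<partial>A\<bar>"
    using fin by (simp add: D_KL_def D_KL_finite_def)
  also have "\<dots> \<le> (\<integral>a. \<bar>p a * ln (p a / gibbs A g a) - p a * ln (p a / gibbs A h a)\<bar> \<partial>A)"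
    by (rule integral_abs_bound)
  also have "\<dots> \<le> (\<integral>a. 2 * \<epsilon> * p a \<partial>A)"
    using fin int_p(1) pointwise by (intro integral_mono) (auto simp: D_KL_finite_def)
  also have "\<dots> = 2 * \<epsilon>"
    by (simp add: int_p(2))
  finally show ?thesis .
qed

section \<open>The bound in expectation\<close>

lemma (in prob_space) abs_integral_diff_le:
  fixes u v :: "'a \<Rightarrow> real"
  assumes "integrable M u" "integrable M v" "AE x in M. \<bar>u x - v x\<bar> \<le> C"
  shows "\<bar>(\<integral>x. u x \<partial>M) - (\<integral>x. v x \<partial>M)\<bar> \<le> C"
proof -
  have "\<bar>(\<integral>x. u x \<partial>M) - (\<integral>x. v x \<partial>M)\<bar> = \<bar>\<integral>x. u x - v x \<partial>M\<bar>"
    using assms by simp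
  also have "\<dots> \<le> (\<integral>x. \<bar>u x - v x\<bar> \<partial>M)"
    by (rule integral_abs_bound)
  also have "\<dots> \<le> C"
    using assms by (intro integral_le_const) auto
  finally show ?thesis .
qed

theorem proposition2:
  fixes M :: "('s, 'o, 'a) networked_mdp"
    and \<pi> :: "('o, 'a) policy"
    and \<nu> :: "('o, 'a) weights"
    and D :: "(nat \<Rightarrow> 'o) measure"
    and \<kappa> i :: nat
    and c \<rho> :: real
  assumes mdp: "is_networked_mdp M"
    and policy: "is_policy M \<pi>"
    and Q_wd: "\<forall>j\<in>agents M. Q_well_defined M \<pi> j"
    and weights: "\<forall>j\<in>agents M. valid_weights M \<pi> \<kappa> \<nu> j"
    and D: "D \<in> space (prob_algebra (Os M (agents M)))"
    and c: "0 \<le> c" and \<rho>: "0 \<le> \<rho>"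
    and decay:
      "\<forall>j\<in>agents M.
         \<forall>oN\<in>space (Os M (nbhd M \<kappa> j)). \<forall>oF\<in>space (Os M (far M \<kappa> j)). \<forall>oF'\<in>space (Os M (far M \<kappa> j)).
         \<forall>aN\<in>space (As M (nbhd M \<kappa> j)). \<forall>aF\<in>space (As M (far M \<kappa> j)). \<forall>aF'\<in>space (As M (far M \<kappa> j)).
           \<bar>Q_split M \<pi> \<kappa> j oN oF aN aF - Q_split M \<pi> \<kappa> j oN oF' aN aF'\<bar> \<le> c * \<rho> ^ (\<kappa> + 1)"
    and truncation:
      "\<forall>j\<in>agents M. \<forall>ob\<in>space (Os M (agents M)). \<forall>a\<in>space (As M (agents M)).
         \<bar>Q_fun M \<pi> j ob a - Q_trunc M \<pi> \<kappa> \<nu> j (restrict ob (nbhd M \<kappa> j)) (restrict a (nbhd M \<kappa> j))\<bar>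
           \<le> c * \<rho> ^ (\<kappa> + 1)"
    and i: "i \<in> agents M"
    and Z_wd:
      "AE (ob, a') in sample_law M \<pi> D i.
         Z_pos_finite (actions M i) (f_exact M \<pi> i ob a') \<and>
         Z_pos_finite (actions M i) (f_trunc M \<pi> \<kappa> \<nu> i ob a')"
    and KL_wd:
      "AE (ob, a') in sample_law M \<pi> D i.
         D_KL_finite (actions M i) (\<pi> i (ob i)) (gibbs (actions M i) (f_exact M \<pi> i ob a')) \<and>
         D_KL_finite (actions M i) (\<pi> i (ob i)) (gibbs (actions M i) (f_trunc M \<pi> \<kappa> \<nu> i ob a'))"
    and E_wd:
      "integrable (sample_law M \<pi> D i)
         (\<lambda>(ob, a'). D_KL (actions M i) (\<pi> i (ob i)) (gibbs (actions M i) (f_exact M \<pi> i ob a')))"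
      "integrable (sample_law M \<pi> D i)
         (\<lambda>(ob, a'). D_KL (actions M i) (\<pi> i (ob i)) (gibbs (actions M i) (f_trunc M \<pi> \<kappa> \<nu> i ob a')))"
  shows
    "\<bar>(\<integral>(ob, a'). D_KL (actions M i) (\<pi> i (ob i)) (gibbs (actions M i) (f_exact M \<pi> i ob a'))
          \<partial>sample_law M \<pi> D i)
      - (\<integral>(ob, a'). D_KL (actions M i) (\<pi> i (ob i)) (gibbs (actions M i) (f_trunc M \<pi> \<kappa> \<nu> i ob a'))
          \<partial>sample_law M \<pi> D i)\<bar>
     \<le> 2 * c * \<rho> ^ (\<kappa> + 1)"
proof -
  let ?S = "sample_law M \<pi> D i"
  have S: "?S \<in> space (prob_algebra (Os M (agents M) \<Otimes>\<^sub>M As M (agents M - {i})))"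
    by (rule sample_law_in_prob_algebra[OF mdp policy D])
  then interpret S: prob_space ?S
    by (simp add: space_prob_algebra)
  have "space ?S = space (Os M (agents M) \<Otimes>\<^sub>M As M (agents M - {i}))"
    using S by (intro sets_eq_imp_space_eq) (simp add: space_prob_algebra)
  then have sample: "AE (ob, a') in ?S. ob \<in> space (Os M (agents M)) \<and> a' \<in> space (As M (agents M - {i}))"
    by (intro AE_I2) (auto simp: space_pair_measure)
  have "AE (ob, a') in ?S.
      \<bar>D_KL (actions M i) (\<pi> i (ob i)) (gibbs (actions M i) (f_exact M \<pi> i ob a'))
        - D_KL (actions M i) (\<pi> i (ob i)) (gibbs (actions M i) (f_trunc M \<pi> \<kappa> \<nu> i ob a'))\<bar>
      \<le> 2 * (c * \<rho> ^ (\<kappa> + 1))"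
    using sample Z_wd KL_wd
  proof eventually_elim
    case (elim z)
    obtain ob a' where z: "z = (ob, a')"
      by fastforce
    have ob: "ob \<in> space (Os M (agents M))" and a': "a' \<in> space (As M (agents M - {i}))"
      using elim(1) z by auto
    have obi: "ob i \<in> space (observations M i)"
      using ob i by (auto simp: space_PiM)
    have agents: "1 \<le> num_agents M"
      using mdp by (simp add: is_networked_mdp_def)
    have "(\<lambda>(ob, a). \<pi> i ob a) \<in> borel_measurable (observations M i \<Otimes>\<^sub>M actions M i)"
      using policy i by (simp add: is_policy_def)
    from measurable_Pair2[OF this obi] have dens: "\<pi> i (ob i) \<in> borel_measurable (actions M i)"
      by simp
    obtain K where K: "\<forall>x\<in>space (actions M i).
        \<bar>f_exact M \<pi> i ob a' x - f_trunc M \<pi> \<kappa> \<nu> i ob a' x - K\<bar> \<le> c * \<rho> ^ (\<kappa> + 1)"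
      using f_exact_f_trunc_near_constant[OF agents decay truncation i ob a'] by blast
    show ?case
      using elim(2,3) unfolding z prod.case
      by (intro D_KL_gibbs_diff_le[OF dens])
         (use policy i obi K in \<open>auto simp: is_policy_def\<close>)
  qed
  then have "AE z in ?S.
      \<bar>(case z of (ob, a') \<Rightarrow> D_KL (actions M i) (\<pi> i (ob i)) (gibbs (actions M i) (f_exact M \<pi> i ob a')))
        - (case z of (ob, a') \<Rightarrow> D_KL (actions M i) (\<pi> i (ob i)) (gibbs (actions M i) (f_trunc M \<pi> \<kappa> \<nu> i ob a')))\<bar>
      \<le> 2 * (c * \<rho> ^ (\<kappa> + 1))"
    by eventually_elim auto
  from S.abs_integral_diff_le[OF E_wd this] show ?thesis
    by (simp add: mult.assoc)
qed

end
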